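(* Let $L$ be a bounded, distributive lattice and let $I$ be a meet semilattice. If $\gamma\colon B^{\updownarrow}(L)\to I$ is an injective meet semilattice homomorphism, then $C=\gamma\circ C^{\sigma}$ is a monotone, distributive lattice form. Conversely, if $C\colon L\times L\to I$ is a monotone, distributive lattice form, then there exists an injective meet semilattice homomorphism $\gamma\colon B^{\updownarrow}(L)\to I$, (well-)defined by $\gamma\bigl(j(a)\setminus j(b)\bigr):=C(a,b)$ for $a,b\in L$, such that $C=\gamma\circ C^{\sigma}$.
   Context: For a bounded distributive lattice $L$ (with $0,1$), let $\Sigma(L)$ be the set of (proper) prime ideals of $L$, i.e. the sets $f^{-1}(0)$ with $f\colon L\to\{0,1\}$ a lattice homomorphism preserving $0$ and $1$. Let $j(a)=\{I\in\Sigma(L)\mid a\notin I\}$ for $a\in L$, and $B^{\updownarrow}(L)=\{j(a)\setminus j(b)\mid a,b\in L\}$, a meet semilattice under intersection. The canonical Conley form is $C^{\sigma}\colon L\times L\to B^{\updownarrow}(L)$, $C^{\sigma}(a,b)=j(a)\setminus j(b)$. A meet semilattice homomorphism is a map preserving binary meets. A lattice form on $L$ in a meet semilattice $I$ is a map $\rho\colon L\times L\to I$ with $\rho(a\vee b,a)=\rho(b,a)$ and $\rho(a,a\wedge b)=\rho(a,b)$ for all $a,b\in L$. It is distributive if $\rho(a\wedge c,b\vee d)=\rho(a,b)\wedge\rho(c,d)$ for all $a,b,c,d\in L$, and monotone if $\rho(a,b)=\rho(0,1)$ implies $a\le b$. *)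

theory Defs
  imports Main
begin

text \<open>
  The two-element lattice is \<^typ>\<open>bool\<close>, with \<^term>\<open>False\<close> as 0 and \<^term>\<open>True\<close> as 1.
  The degenerate lattice with 0 = 1 is not excluded: it has no prime ideals.
\<close>

definition bounded_lattice_hom ::
  "('a::bounded_lattice \<Rightarrow> 'b::bounded_lattice) \<Rightarrow> bool" where
  "bounded_lattice_hom f \<longleftrightarrow>
     f bot = bot \<and> f top = top \<and>
     (\<forall>a b. f (inf a b) = inf (f a) (f b)) \<and>
     (\<forall>a b. f (sup a b) = sup (f a) (f b))"

definition prime_ideals :: "'a::{distrib_lattice,bounded_lattice} set set" where
  "prime_ideals = {f -` {bot} | f :: 'a \<Rightarrow> bool. bounded_lattice_hom f}"

definition jmap :: "'a::{distrib_lattice,bounded_lattice} \<Rightarrow> 'a set set" where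
  "jmap a = {P \<in> prime_ideals. a \<notin> P}"

definition Bupdown :: "'a::{distrib_lattice,bounded_lattice} set set set" where
  "Bupdown = {jmap a - jmap b | a b. True}"

definition Csigma :: "'a::{distrib_lattice,bounded_lattice} \<times> 'a \<Rightarrow> 'a set set" where
  "Csigma = (\<lambda>(a, b). jmap a - jmap b)"

text \<open>
  \<^term>\<open>Bupdown\<close> is a meet semilattice under intersection, by the following closure property.
  Maps out of it are total functions of which only the values on \<^term>\<open>Bupdown\<close> matter.
\<close>

lemma Csigma_Int:
  fixes a b c d :: "'a::{distrib_lattice,bounded_lattice}"
  shows "Csigma (a, b) \<inter> Csigma (c, d) = Csigma (inf a c, sup b d)"
proof -
  have "(inf x y \<notin> P \<longleftrightarrow> x \<notin> P \<and> y \<notin> P) \<and> (sup x y \<in> P \<longleftrightarrow> x \<in> P \<and> y \<in> P)"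
    if P: "P \<in> prime_ideals" for P and x y :: 'a
  proof -
    obtain f :: "'a \<Rightarrow> bool" where "P = f -` {bot}" and "bounded_lattice_hom f"
      using P unfolding prime_ideals_def by blast
    then show ?thesis
      by (simp add: bounded_lattice_hom_def)
  qed
  then show ?thesis
    unfolding Csigma_def jmap_def prod.case by blast
qed

lemma Bupdown_Int_closed:
  assumes "U \<in> Bupdown" and "V \<in> Bupdown"
  shows "U \<inter> V \<in> Bupdown"
proof -
  obtain a b c d where "U = Csigma (a, b)" "V = Csigma (c, d)"
    using assms by (auto simp: Bupdown_def Csigma_def)
  then have "U \<inter> V = Csigma (inf a c, sup b d)"
    by (simp add: Csigma_Int)
  then show ?thesis
    by (auto simp: Bupdown_def Csigma_def)
qed

definition meet_hom_on :: "'x set set \<Rightarrow> ('x set \<Rightarrow> 'i::semilattice_inf) \<Rightarrow> bool" where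
  "meet_hom_on S g \<longleftrightarrow> (\<forall>U\<in>S. \<forall>V\<in>S. g (U \<inter> V) = inf (g U) (g V))"

definition lattice_form ::
  "('a::{distrib_lattice,bounded_lattice} \<times> 'a \<Rightarrow> 'i::semilattice_inf) \<Rightarrow> bool" where
  "lattice_form C \<longleftrightarrow>
     (\<forall>a b. C (sup a b, a) = C (b, a)) \<and> (\<forall>a b. C (a, inf a b) = C (a, b))"

definition distributive_form ::
  "('a::{distrib_lattice,bounded_lattice} \<times> 'a \<Rightarrow> 'i::semilattice_inf) \<Rightarrow> bool" where
  "distributive_form C \<longleftrightarrow>
     (\<forall>a b c d. C (inf a c, sup b d) = inf (C (a, b)) (C (c, d)))"

definition monotone_form ::
  "('a::{distrib_lattice,bounded_lattice} \<times> 'a \<Rightarrow> 'i::semilattice_inf) \<Rightarrow> bool" where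
  "monotone_form C \<longleftrightarrow> (\<forall>a b. C (a, b) = C (bot, top) \<longrightarrow> a \<le> b)"

end

theory Submission
  imports Defs
begin

text \<open>
  By the prime ideal theorem \<^term>\<open>jmap\<close> is an order embedding, so the inclusion of
  $j(a) \setminus j(b)$ in $j(c) \setminus j(d)$ amounts to the two inequalities
  $a \le b \vee c$ and $a \wedge d \le b$. For a distributive lattice form they imply
  $C(a,b) \le C(c,d)$, and if the form is monotone the converse holds too, because
  $C(x,y) = C(0,1)$ whenever $x \le y$. Hence $j(a) \setminus j(b) \mapsto C(a,b)$ is
  well defined and injective.
\<close>

text \<open>Zorn's lemma yields an ideal \<open>M\<close> maximal among those containing
  \<open>b\<close> and avoiding \<open>a\<close>; distributivity makes such an ideal prime.\<close>

lemma prime_ideal_separation: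
  fixes a b :: "'a::{distrib_lattice,bounded_lattice}"
  assumes "\<not> a \<le> b"
  obtains P where "P \<in> prime_ideals" "b \<in> P" "a \<notin> P"
proof -
  \<comment> \<open>Containing \<open>b\<close> makes each \<open>S\<close> nonempty and avoiding
    \<open>a\<close> makes it proper, so the members of \<open>A\<close> are genuine proper
    ideals.\<close>
  define A where "A = {S :: 'a set. b \<in> S \<and> a \<notin> S
    \<and> (\<forall>x y. x \<le> y \<longrightarrow> y \<in> S \<longrightarrow> x \<in> S) \<and> (\<forall>x\<in>S. \<forall>y\<in>S. sup x y \<in> S)}"
  have "\<exists>M\<in>A. \<forall>X\<in>A. M \<subseteq> X \<longrightarrow> X = M"
  proof (rule subset_Zorn_nonempty)
    have "{..b} \<in> A"
      using assms by (auto simp: A_def)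
    then show "A \<noteq> {}"
      by blast
  next
    fix K assume "K \<noteq> {}" and K: "subset.chain A K"
    have KA: "K \<subseteq> A" and lin: "\<And>X Y. X \<in> K \<Longrightarrow> Y \<in> K \<Longrightarrow> X \<subseteq> Y \<or> Y \<subseteq> X"
      using K by (auto simp: subset_chain_def)
    have "sup x y \<in> \<Union>K" if "x \<in> X" "X \<in> K" "y \<in> Y" "Y \<in> K" for x y X Y
    proof -
      obtain Z where "Z \<in> K" "x \<in> Z" "y \<in> Z"
        using lin \<open>x \<in> X\<close> \<open>X \<in> K\<close> \<open>y \<in> Y\<close> \<open>Y \<in> K\<close> by blast
      moreover from this have "sup x y \<in> Z"
        using KA by (auto simp: A_def)
      ultimately show ?thesis
        by blast
    qed
    moreover have "x \<in> \<Union>K" if "x \<le> y" "y \<in> \<Union>K" for x y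
      using that KA unfolding A_def by blast
    moreover have "b \<in> \<Union>K" "a \<notin> \<Union>K"
      using \<open>K \<noteq> {}\<close> KA by (auto simp: A_def)
    ultimately show "\<Union>K \<in> A"
      unfolding A_def by blast
  qed
  then obtain M where "M \<in> A" and max: "\<And>X. X \<in> A \<Longrightarrow> M \<subseteq> X \<Longrightarrow> X = M"
    by blast
  then have bM: "b \<in> M" and aM: "a \<notin> M"
    and down: "\<And>x y. x \<le> y \<Longrightarrow> y \<in> M \<Longrightarrow> x \<in> M"
    and sup: "\<And>x y. x \<in> M \<Longrightarrow> y \<in> M \<Longrightarrow> sup x y \<in> M"
    unfolding A_def by blast+
  \<comment> \<open>Otherwise the ideal generated by \<open>M\<close> and \<open>x\<close> would contradict maximality.\<close>
  have gen: "\<exists>m\<in>M. a \<le> sup m x" if "x \<notin> M" for x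
  proof (rule ccontr)
    assume neg: "\<not> ?thesis"
    define X where "X = {y. \<exists>m\<in>M. y \<le> sup m x}"
    have "M \<subseteq> X" "x \<in> X"
      using bM by (auto simp: X_def intro: le_supI1)
    moreover have "sup y z \<in> X" if yz: "y \<in> X" "z \<in> X" for y z
    proof -
      obtain m n where "m \<in> M" "y \<le> sup m x" "n \<in> M" "z \<le> sup n x"
        using yz unfolding X_def by blast
      moreover from this have "sup y z \<le> sup (sup m x) (sup n x)"
        by (intro sup_mono)
      moreover have "\<dots> = sup (sup m n) x"
        by (simp add: sup_commute sup_left_commute)
      ultimately show ?thesis
        using sup by (auto simp: X_def)
    qed
    moreover have "y \<in> X" if "y \<le> z" "z \<in> X" for y z
      using that unfolding X_def by (blast intro: order_trans)
    moreover have "a \<notin> X"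
      using neg by (auto simp: X_def)
    ultimately have "X \<in> A"
      using bM unfolding A_def by blast
    with max \<open>M \<subseteq> X\<close> \<open>x \<in> X\<close> \<open>x \<notin> M\<close> show False
      by blast
  qed
  \<comment> \<open>The witnesses from \<open>gen\<close> are merged into \<open>sup m n\<close>;
    distributivity then puts \<open>a\<close> below \<open>sup (sup m n) (inf x y)\<close>, which
    would lie in \<open>M\<close>.\<close>
  have prime: "inf x y \<notin> M" if xyM: "x \<notin> M" "y \<notin> M" for x y
  proof
    assume xy: "inf x y \<in> M"
    obtain m n where "m \<in> M" "a \<le> sup m x" "n \<in> M" "a \<le> sup n y"
      using gen[OF xyM(1)] gen[OF xyM(2)] by blast
    have "sup m x \<le> sup (sup m n) x" "sup n y \<le> sup (sup m n) y"
      by (intro sup_mono sup_ge1 sup_ge2 order_refl)+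
    then have "a \<le> inf (sup (sup m n) x) (sup (sup m n) y)"
      using \<open>a \<le> sup m x\<close> \<open>a \<le> sup n y\<close> by (blast intro: le_infI order_trans)
    also have "\<dots> = sup (sup m n) (inf x y)"
      by (simp add: sup_inf_distrib1)
    finally show False
      using aM down sup xy \<open>m \<in> M\<close> \<open>n \<in> M\<close> by blast
  qed
  \<comment> \<open>The complement is taken because a prime ideal is the preimage of
    \<open>bot\<close>, that is, of \<open>False\<close>.\<close>
  have "bounded_lattice_hom (\<lambda>x. x \<notin> M)"
    unfolding bounded_lattice_hom_def
  proof (intro conjI allI)
    show "(bot \<notin> M) = bot" "(top \<notin> M) = top"
      using down[of bot b] down[of a top] aM bM by auto
    show "(inf x y \<notin> M) = inf (x \<notin> M) (y \<notin> M)" for x y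
      using prime[of x y] down[of "inf x y" x] down[of "inf x y" y] by auto
    show "(sup x y \<notin> M) = sup (x \<notin> M) (y \<notin> M)" for x y
      using sup[of x y] down[of x "sup x y"] down[of y "sup x y"] by auto
  qed
  moreover have "M = (\<lambda>x. x \<notin> M) -` {bot}"
    by auto
  ultimately have "M \<in> prime_ideals"
    unfolding prime_ideals_def by blast
  then show ?thesis
    using that bM aM by blast
qed

lemma jmap_inf: "jmap (inf a b) = jmap a \<inter> jmap b"
  and jmap_sup: "jmap (sup a b) = jmap a \<union> jmap b"
proof -
  have "(inf a b \<in> P \<longleftrightarrow> a \<in> P \<or> b \<in> P) \<and> (sup a b \<in> P \<longleftrightarrow> a \<in> P \<and> b \<in> P)"
    if P: "P \<in> prime_ideals" for P
  proof -
    obtain f :: "'a \<Rightarrow> bool" where "P = f -` {bot}" "bounded_lattice_hom f"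
      using P unfolding prime_ideals_def by blast
    then show ?thesis
      by (simp add: bounded_lattice_hom_def)
  qed
  then show "jmap (inf a b) = jmap a \<inter> jmap b" "jmap (sup a b) = jmap a \<union> jmap b"
    unfolding jmap_def by blast+
qed

lemma jmap_subset_iff: "jmap a \<subseteq> jmap b \<longleftrightarrow> a \<le> b"
proof
  show "a \<le> b" if "jmap a \<subseteq> jmap b"
    by (rule ccontr, erule prime_ideal_separation) (use that in \<open>auto simp: jmap_def\<close>)
  show "jmap a \<subseteq> jmap b" if "a \<le> b"
    using jmap_inf[of a b] that by (auto simp: inf_absorb1)
qed

text \<open>The inclusion splits into \<open>jmap a \<subseteq> jmap b \<union> jmap c\<close> and
  \<open>jmap a \<inter> jmap d \<subseteq> jmap b\<close>, and \<open>jmap\<close> reflects each to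
  an inequality in the lattice.\<close>

lemma Csigma_subset_iff: "Csigma (a, b) \<subseteq> Csigma (c, d) \<longleftrightarrow> a \<le> sup b c \<and> inf a d \<le> b"
  using jmap_subset_iff[of a "sup b c"] jmap_subset_iff[of "inf a d" b]
  by (auto simp: Csigma_def jmap_inf jmap_sup)

text \<open>Both laws are set identities for \<open>Csigma\<close>, and \<open>\<gamma>\<close>
  carries equal sets to equal values.\<close>

lemma lattice_form_comp_Csigma: "lattice_form (\<gamma> \<circ> Csigma)"
  by (auto simp: lattice_form_def Csigma_def jmap_inf jmap_sup intro!: arg_cong[of _ _ \<gamma>])

lemma Csigma_in_Bupdown: "Csigma p \<in> Bupdown"
  by (cases p) (auto simp: Csigma_def Bupdown_def)

lemma distributive_form_comp_Csigma:
  assumes "meet_hom_on Bupdown \<gamma>"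
  shows "distributive_form (\<gamma> \<circ> Csigma)"
  using assms Csigma_in_Bupdown
  by (auto simp: distributive_form_def meet_hom_on_def simp flip: Csigma_Int)

lemma monotone_form_comp_Csigma:
  assumes "inj_on \<gamma> Bupdown"
  shows "monotone_form (\<gamma> \<circ> Csigma)"
  unfolding monotone_form_def
proof (intro allI impI)
  fix a b :: 'a
  assume "(\<gamma> \<circ> Csigma) (a, b) = (\<gamma> \<circ> Csigma) (bot, top)"
  then have "Csigma (a, b) = Csigma (bot, top)"
    using assms by (simp add: inj_on_eq_iff Csigma_in_Bupdown)
  \<comment> \<open>With \<open>c = bot\<close> and \<open>d = top\<close>, both inequalities of
    \<open>Csigma_subset_iff\<close> collapse to \<open>a \<le> b\<close>.\<close>
  then have "Csigma (a, b) \<subseteq> Csigma (bot, top)"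
    by simp
  then show "a \<le> b"
    by (simp add: Csigma_subset_iff)
qed

text \<open>This is the converse of monotonicity. The arguments are changed one at a time, through
  \<open>C (a, a)\<close> and \<open>C (a, top)\<close>.\<close>

lemma lattice_form_le:
  assumes "lattice_form C" and "a \<le> b"
  shows "C (a, b) = C (bot, top)"
proof -
  have sup: "C (sup x y, x) = C (y, x)" and inf: "C (x, inf x y) = C (x, y)" for x y
    using assms(1) by (auto simp: lattice_form_def)
  have "C (a, b) = C (a, a)"
    using inf[of a b] \<open>a \<le> b\<close> by (simp add: inf_absorb1)
  also have "\<dots> = C (a, top)"
    using inf[of a top] by simp
  \<comment> \<open>Both sides equal \<open>C (top, top)\<close>.\<close>
  also have "\<dots> = C (bot, top)"
    using sup[of top a] sup[of top bot] by simp
  finally show ?thesis .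
qed

lemma form_le_iff_Csigma_subset:
  assumes C: "lattice_form C" "distributive_form C" "monotone_form C"
  shows "C (a, b) \<le> C (c, d) \<longleftrightarrow> Csigma (a, b) \<subseteq> Csigma (c, d)"
proof -
  have sup: "C (sup x y, x) = C (y, x)" and inf: "C (x, inf x y) = C (x, y)" for x y
    using C(1) by (auto simp: lattice_form_def)
  have dist: "C (inf x z, sup y w) = inf (C (x, y)) (C (z, w))" for x y z w
    using C(2) by (auto simp: distributive_form_def)
  have mono: "x \<le> y" if "C (x, y) = C (bot, top)" for x y
    using C(3) that by (auto simp: monotone_form_def)
  have "C (a, b) \<le> C (c, d)" if "a \<le> sup b c" "inf a d \<le> b"
  proof -
    \<comment> \<open>By the law \<open>inf\<close>, the second argument of \<open>C\<close> matters
      only through its meet with the first, so \<open>sup b d\<close> may be replaced by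
      \<open>b\<close> once these meets agree.\<close>
    have "inf (inf a c) (sup b d) = inf c (sup (inf a b) (inf a d))"
      by (simp add: inf_sup_distrib1 inf_commute inf_left_commute)
    also have "sup (inf a b) (inf a d) = inf a b"
      using that(2) by (simp add: sup_absorb1)
    finally have "inf (inf a c) (sup b d) = inf (inf a c) b"
      by (simp add: inf_commute inf_left_commute)
    then have "C (inf a c, sup b d) = C (inf a c, b)"
      by (metis inf)
    \<comment> \<open>Dually, the first argument matters only through its join with the
      second.\<close>
    also have "\<dots> = C (sup b (inf a c), b)"
      by (simp add: sup)
    also have "sup b (inf a c) = sup b a"
      using that(1) by (simp add: sup_inf_distrib1 inf_absorb1)
    also have "C (sup b a, b) = C (a, b)"
      by (rule sup)
    finally show ?thesis
      by (metis dist inf_le2)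
  qed
  moreover have "a \<le> sup b c \<and> inf a d \<le> b" if "C (a, b) \<le> C (c, d)"
  proof -
    have eq: "C (a, b) = C (inf a c, sup b d)"
      using that by (simp add: dist inf_absorb1)
    \<comment> \<open>Meeting with \<open>C (top, c)\<close> joins \<open>c\<close> to the second
      argument and keeps the first. After rewriting by \<open>eq\<close>, the first argument lies
      below the second, which forces the value \<open>C (bot, top)\<close>.\<close>
    have "C (a, sup b c) = inf (C (a, b)) (C (top, c))"
      by (simp flip: dist)
    also have "\<dots> = C (inf a c, sup (sup b d) c)"
      unfolding eq by (simp flip: dist)
    also have "\<dots> = C (bot, top)"
      by (rule lattice_form_le[OF C(1)]) (simp add: le_infI2)
    finally have 1: "a \<le> sup b c"
      by (rule mono)
    \<comment> \<open>Dually, meeting with \<open>C (d, bot)\<close> changes only the first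
      argument.\<close>
    have "C (inf a d, b) = inf (C (a, b)) (C (d, bot))"
      by (simp flip: dist)
    also have "\<dots> = C (inf (inf a c) d, sup b d)"
      unfolding eq by (simp flip: dist)
    also have "\<dots> = C (bot, top)"
      by (rule lattice_form_le[OF C(1)]) (simp add: le_infI2)
    finally have "inf a d \<le> b"
      by (rule mono)
    with 1 show ?thesis ..
  qed
  ultimately show ?thesis
    unfolding Csigma_subset_iff by blast
qed

text \<open>Antisymmetry on both sides. From right to left this makes the induced map well defined,
  from left to right injective.\<close>

lemma form_eq_iff_Csigma_eq:
  assumes "lattice_form C" "distributive_form C" "monotone_form C"
  shows "C p = C q \<longleftrightarrow> Csigma p = Csigma q"
proof (cases p, cases q)
  fix a b c d assume [simp]: "p = (a, b)" "q = (c, d)"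
  show ?thesis
    unfolding order.eq_iff[of "C p"] set_eq_subset by (simp add: form_le_iff_Csigma_subset[OF assms])
qed

lemma form_factors_through_Csigma:
  assumes C: "lattice_form C" "distributive_form C" "monotone_form C"
  obtains \<gamma> where "meet_hom_on Bupdown \<gamma>" "inj_on \<gamma> Bupdown" "C = \<gamma> \<circ> Csigma"
proof -
  \<comment> \<open>The value is read off from an arbitrary representing pair. Outside
    \<open>Bupdown\<close> no such pair exists and the value is unspecified.\<close>
  define \<gamma> where "\<gamma> U = C (SOME p. Csigma p = U)" for U
  have \<gamma>: "\<gamma> (Csigma p) = C p" for p
  proof -
    have "Csigma (SOME q. Csigma q = Csigma p) = Csigma p"
      by (rule someI) (rule refl)
    then show ?thesis
      by (simp add: \<gamma>_def form_eq_iff_Csigma_eq[OF C])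
  qed
  have B: "Bupdown = range Csigma"
    by (auto simp: Bupdown_def Csigma_def image_def)
  show ?thesis
  proof
    show "meet_hom_on Bupdown \<gamma>"
      using C(2) by (auto simp: meet_hom_on_def B Csigma_Int \<gamma> distributive_form_def)
    show "inj_on \<gamma> Bupdown"
      by (auto simp: inj_on_def B \<gamma> form_eq_iff_Csigma_eq[OF C])
    show "C = \<gamma> \<circ> Csigma"
      by (auto simp: \<gamma>)
  qed
qed

theorem theorem4p2:
  shows "(\<forall>(\<gamma> :: 'a::{distrib_lattice,bounded_lattice} set set \<Rightarrow> 'i::semilattice_inf) C.
            meet_hom_on Bupdown \<gamma> \<and> inj_on \<gamma> Bupdown \<and> C = \<gamma> \<circ> Csigma
            \<longrightarrow> lattice_form C \<and> distributive_form C \<and> monotone_form C)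
       \<and> (\<forall>C :: 'a \<times> 'a \<Rightarrow> 'i.
            lattice_form C \<and> distributive_form C \<and> monotone_form C
            \<longrightarrow> (\<forall>a b c d. jmap a - jmap b = jmap c - jmap d \<longrightarrow> C (a, b) = C (c, d))
              \<and> (\<exists>\<gamma> :: 'a set set \<Rightarrow> 'i.
                    meet_hom_on Bupdown \<gamma> \<and> inj_on \<gamma> Bupdown
                  \<and> (\<forall>a b. \<gamma> (jmap a - jmap b) = C (a, b))
                  \<and> C = \<gamma> \<circ> Csigma))"
proof (intro conjI allI impI; elim conjE)
  fix \<gamma> :: "'a set set \<Rightarrow> 'i" and C
  assume "meet_hom_on Bupdown \<gamma>" "inj_on \<gamma> Bupdown" "C = \<gamma> \<circ> Csigma"
  then show "lattice_form C" "distributive_form C" "monotone_form C"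
    by (auto intro: lattice_form_comp_Csigma distributive_form_comp_Csigma
        monotone_form_comp_Csigma)
next
  fix C :: "'a \<times> 'a \<Rightarrow> 'i"
  assume C: "lattice_form C" "distributive_form C" "monotone_form C"
  show "C (a, b) = C (c, d)" if "jmap a - jmap b = jmap c - jmap d" for a b c d
    using that by (simp add: form_eq_iff_Csigma_eq[OF C] Csigma_def)
  obtain \<gamma> where \<gamma>: "meet_hom_on Bupdown \<gamma>" "inj_on \<gamma> Bupdown" "C = \<gamma> \<circ> Csigma"
    using form_factors_through_Csigma[OF C] .
  moreover have "\<gamma> (jmap a - jmap b) = C (a, b)" for a b
    by (simp add: \<gamma>(3) Csigma_def)
  ultimately show "\<exists>\<gamma>. meet_hom_on Bupdown \<gamma> \<and> inj_on \<gamma> Bupdown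
      \<and> (\<forall>a b. \<gamma> (jmap a - jmap b) = C (a, b)) \<and> C = \<gamma> \<circ> Csigma"
    by blast
qed

end
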